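(* Let $n \geq 2$ be a natural number and let $G_1, G_2, \ldots, G_n$ be arbitrary (finite, simple) graphs. Then $$\Gamma_3\Big(\bigoplus_{i=1}^{n} G_i\Big) \cong \bigoplus_{i=1}^n \Gamma_3(G_i) \;\oplus \bigoplus_{1\leq i,j\leq n,\ i\neq j} (\Gamma_2(G_i) \square G_j) \;\oplus \bigoplus_{1\leq i<j<k\leq n} (G_i \square G_j \square G_k).$$
   Context: All graphs are finite, simple and undirected. For a graph $G$ and a natural number $k$, the $k$-token graph $\Gamma_k(G)$ has as vertex set the collection of all $k$-element subsets of $V(G)$ (it is the graph with no vertices if $|V(G)|<k$), and two distinct $k$-subsets $A,B$ are adjacent if and only if $A \triangle B = \{x,y\}$ with $xy \in E(G)$. $\oplus$ (and $\bigoplus$) denotes disjoint union of graphs, and $G \square H$ denotes the Cartesian product: vertex set $V(G)\times V(H)$, with $(g,h)$ adjacent to $(g',h')$ iff either $g=g'$ and $hh' \in E(H)$, or $h=h'$ and $gg'\in E(G)$. *)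

theory Defs
  imports "Graph_Theory.Pair_Digraph" "Graph_Theory.Digraph_Isomorphism"
begin

text \<open>
  A finite simple undirected graph is a \<^locale>\<open>pair_graph\<close>: a finite, loop-free, symmetric
  digraph without parallel arcs, so that an edge $xy$ is represented by the two arcs
  $(x,y)$ and $(y,x)$. The null graph is allowed.
\<close>

definition token_graph :: "nat \<Rightarrow> 'a pair_pre_digraph \<Rightarrow> 'a set pair_pre_digraph" where
  "token_graph k G =
    (let V = {A. A \<subseteq> pverts G \<and> finite A \<and> card A = k} in
     \<lparr> pverts = V,
       parcs = {(A, B). A \<in> V \<and> B \<in> V \<and> A \<noteq> B \<and>
                  (\<exists>x y. sym_diff A B = {x, y} \<and> (x, y) \<in> parcs G)} \<rparr>)"

definition disjoint_union ::
    "'a pair_pre_digraph \<Rightarrow> 'b pair_pre_digraph \<Rightarrow> ('a + 'b) pair_pre_digraph"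
    (infixl \<open>\<oplus>\<close> 65) where
  "G \<oplus> H =
    \<lparr> pverts = pverts G <+> pverts H,
      parcs = {(Inl u, Inl v) | u v. (u, v) \<in> parcs G} \<union>
              {(Inr u, Inr v) | u v. (u, v) \<in> parcs H} \<rparr>"

text \<open>The summands are tagged by their index, so their vertex sets may overlap.\<close>

definition indexed_disjoint_union ::
    "'i set \<Rightarrow> ('i \<Rightarrow> 'a pair_pre_digraph) \<Rightarrow> ('i \<times> 'a) pair_pre_digraph" where
  "indexed_disjoint_union I G =
    \<lparr> pverts = (SIGMA i:I. pverts (G i)),
      parcs = {((i, u), (i, v)) | i u v. i \<in> I \<and> (u, v) \<in> parcs (G i)} \<rparr>"

definition cartesian_product ::
    "'a pair_pre_digraph \<Rightarrow> 'b pair_pre_digraph \<Rightarrow> ('a \<times> 'b) pair_pre_digraph"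
    (infixl \<open>\<box>\<close> 70) where
  "G \<box> H =
    (let V = pverts G \<times> pverts H in
     \<lparr> pverts = V,
       parcs = {((g, h), (g', h')). (g, h) \<in> V \<and> (g', h') \<in> V \<and>
                  (g = g' \<and> (h, h') \<in> parcs H \<or> h = h' \<and> (g, g') \<in> parcs G)} \<rparr>)"

lemma pair_graph_iff:
  "pair_graph G \<longleftrightarrow> finite (pverts G) \<and> parcs G \<subseteq> pverts G \<times> pverts G \<and>
     sym (parcs G) \<and> irrefl (parcs G)"
    (is "?L \<longleftrightarrow> ?R")
proof
  assume ?L
  then interpret pair_graph G .
  show ?R
    using pair_finite_verts arc_fst_in_verts arc_snd_in_verts no_loops' pair_sym_arcs
    by (fastforce simp: symmetric_def irrefl_def)
next
  assume R: ?R
  then have "finite (parcs G)" by (auto intro: finite_subset)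
  with R show ?L
    by unfold_locales (auto simp: symmetric_def irrefl_def)
qed

lemma pair_graph_token_graph:
  assumes "pair_graph G"
  shows "pair_graph (token_graph k G)"
proof -
  have "finite {A. A \<subseteq> pverts G \<and> finite A \<and> card A = k}"
    using assms by (auto simp: pair_graph_iff intro: finite_subset[of _ "Pow (pverts G)"])
  moreover have "sym (parcs (token_graph k G))"
    unfolding token_graph_def Let_def sym_def by (auto simp: Un_commute)
  ultimately show ?thesis
    unfolding pair_graph_iff by (auto simp: token_graph_def Let_def irrefl_def)
qed

lemma pair_graph_disjoint_union:
  "pair_graph G \<Longrightarrow> pair_graph H \<Longrightarrow> pair_graph (G \<oplus> H)"
  by (auto simp: pair_graph_iff disjoint_union_def irrefl_def intro!: symI dest: symD)

lemma pair_graph_indexed_disjoint_union: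
  assumes "finite I" and "\<And>i. i \<in> I \<Longrightarrow> pair_graph (G i)"
  shows "pair_graph (indexed_disjoint_union I G)"
  using assms
  by (fastforce simp: pair_graph_iff indexed_disjoint_union_def irrefl_def intro!: symI dest: symD)

lemma pair_graph_cartesian_product:
  "pair_graph G \<Longrightarrow> pair_graph H \<Longrightarrow> pair_graph (G \<box> H)"
  by (auto simp: pair_graph_iff cartesian_product_def Let_def irrefl_def intro!: symI dest: symD)

text \<open>
  \<^const>\<open>digraph_iso\<close> speaks about general digraphs, with separate maps for vertices and arcs.
  On pair digraphs it is the usual notion of graph isomorphism.
\<close>

lemma digraph_iso_with_proj_iff:
  assumes "pair_wf_digraph G" and "pair_wf_digraph H"
  shows "digraph_iso (with_proj G) (with_proj H) \<longleftrightarrow>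
    (\<exists>f. bij_betw f (pverts G) (pverts H) \<and>
      (\<forall>u\<in>pverts G. \<forall>v\<in>pverts G. (u, v) \<in> parcs G \<longleftrightarrow> (f u, f v) \<in> parcs H))"
    (is "?L \<longleftrightarrow> ?R")
proof
  interpret G: pair_wf_digraph G by fact
  assume ?L
  then obtain h where h: "pre_digraph.digraph_isomorphism (with_proj G) h"
    and H: "with_proj H = app_iso h (with_proj G)"
    unfolding digraph_iso_def by blast
  let ?f = "iso_verts h"
  have inj: "inj_on ?f (pverts G)"
    using h by (simp add: pre_digraph.digraph_isomorphism_def)
  have V: "pverts H = ?f ` pverts G"
    using arg_cong[OF H, of verts] by simp
  have ht: "iso_tail h = fst" "iso_head h = snd"
    using arg_cong[OF H, of tail] arg_cong[OF H, of head] by simp_all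
  have arc: "iso_arcs h a = (?f (fst a), ?f (snd a))" if "a \<in> parcs G" for a
    using h that by (simp add: pre_digraph.digraph_isomorphism_def ht prod_eq_iff)
  have A: "parcs H = (\<lambda>a. (?f (fst a), ?f (snd a))) ` parcs G"
    using arg_cong[OF H, of arcs] arc by (simp cong: image_cong)
  have "(u, v) \<in> parcs G \<longleftrightarrow> (?f u, ?f v) \<in> parcs H"
    if "u \<in> pverts G" "v \<in> pverts G" for u v
    proof
    assume "(u, v) \<in> parcs G"
    then show "(?f u, ?f v) \<in> parcs H" unfolding A by force
  next
    assume "(?f u, ?f v) \<in> parcs H"
    then obtain u' v' where e: "(u', v') \<in> parcs G" "?f u = ?f u'" "?f v = ?f v'"
      unfolding A by auto
    with that inj have "u = u'" "v = v'"
      by (blast dest: inj_onD G.in_arcsD1 G.in_arcsD2)+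
    with e show "(u, v) \<in> parcs G" by simp
  qed
  with inj V show ?R by (auto simp: bij_betw_def)
next
  interpret G: pair_wf_digraph G by fact
  interpret H: pair_wf_digraph H by fact
  assume ?R
  then obtain f where bij: "bij_betw f (pverts G) (pverts H)"
    and adj: "\<And>u v. u \<in> pverts G \<Longrightarrow> v \<in> pverts G \<Longrightarrow> (u, v) \<in> parcs G \<longleftrightarrow> (f u, f v) \<in> parcs H"
    by blast
  have inj: "inj_on f (pverts G)" and V: "pverts H = f ` pverts G"
    using bij by (auto simp: bij_betw_def)
  let ?h = "\<lparr> iso_verts = f, iso_arcs = map_prod f f, iso_head = snd, iso_tail = fst \<rparr>"
  have "inj_on (map_prod f f) (parcs G)"
    using inj by (intro inj_on_subset[OF map_prod_inj_on[OF inj inj]])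
      (auto dest: G.in_arcsD1 G.in_arcsD2)
  then have "pre_digraph.digraph_isomorphism (with_proj G) ?h"
    using inj G.wf_digraph_axioms by (simp add: pre_digraph.digraph_isomorphism_def)
  moreover have "parcs H = map_prod f f ` parcs G"
  proof (intro set_eqI iffI)
    fix e assume e: "e \<in> parcs H"
    then obtain u v where "u \<in> pverts G" "v \<in> pverts G" "e = (f u, f v)"
      using H.in_arcsD1 H.in_arcsD2 V by (cases e) blast
    with e adj show "e \<in> map_prod f f ` parcs G" by force
    next
    fix e assume "e \<in> map_prod f f ` parcs G"
    then obtain u v where "(u, v) \<in> parcs G" "e = (f u, f v)" by force
    then show "e \<in> parcs H" using adj G.in_arcsD1 G.in_arcsD2 by blast
  qed
  then have "with_proj H = app_iso ?h (with_proj G)"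
    by (simp add: with_proj_def app_iso_def V)
  ultimately show ?L unfolding digraph_iso_def by blast
qed

end

theory Submission
  imports Defs
begin

text \<open>
  A set of tokens on a disjoint union is determined by its fibres \<open>S `` {i}\<close>, and a token move
  changes exactly one fibre, without changing its cardinality. Hence the profile
  \<open>\<lambda>i. card (S `` {i})\<close> is constant on connected components. For three tokens the profiles are
  \<open>3\<close>, \<open>2 + 1\<close> and \<open>1 + 1 + 1\<close>, and the token sets of a given profile form exactly one of
  the claimed summands.
\<close>

section \<open>Token moves and fibres of a disjoint union\<close>

text \<open>An oriented form of token graph adjacency. Unlike the symmetric difference it names the
  token that moves and its free target, so it can be localised in a single fibre.\<close>

definition token_move :: "('a \<times> 'a) set \<Rightarrow> 'a set \<Rightarrow> 'a set \<Rightarrow> bool" where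
  "token_move E A B \<longleftrightarrow> (\<exists>x y. (x, y) \<in> E \<and> x \<in> A \<and> y \<notin> A \<and> B = insert y (A - {x}))"

lemma card_token_move:
  assumes "token_move E A B"
  shows "card B = card A"
proof (cases "finite A")
  case True
  with assms show ?thesis
    by (auto simp: token_move_def card_insert_if) (metis Suc_pred card_gt_0_iff empty_iff)
next
  \<comment> \<open>For infinite sets both cardinalities are 0 by convention.\<close>
  case False
  with assms show ?thesis by (auto simp: token_move_def)
qed

lemma token_move_empty [simp]: "\<not> token_move E {} B"
  by (simp add: token_move_def)

text \<open>Irreflexivity is what makes the target of an arc leaving \<open>a\<close>
  unoccupied.\<close>

lemma token_move_singleton:
  assumes "irrefl E"
  shows "token_move E {a} {b} \<longleftrightarrow> (a, b) \<in> E"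
  using assms by (auto simp: token_move_def irrefl_def)

text \<open>Sets of equal size lose as many elements as they gain, so a symmetric difference
  \<open>{x, y}\<close> consists of one vertex left and one vertex entered. Which of
  \<open>x\<close> and \<open>y\<close> is which does not matter, because arcs come in both
  directions.\<close>

lemma parcs_token_graph_iff:
  assumes "pair_graph G" and "A \<in> pverts (token_graph k G)" and "B \<in> pverts (token_graph k G)"
  shows "(A, B) \<in> parcs (token_graph k G) \<longleftrightarrow> token_move (parcs G) A B"
proof -
  have sym: "sym (parcs G)"
    using assms(1) by (auto simp: pair_graph_iff)
  have fin: "finite A" "finite B" and eq: "card A = card B"
    using assms(2,3) by (auto simp: token_graph_def Let_def)
  have diff: "card (A - B) = card (B - A)"
    using fin eq by (metis card_le_sym_Diff nle_le)
  have "(A \<noteq> B \<and> (\<exists>x y. sym_diff A B = {x, y} \<and> (x, y) \<in> parcs G)) \<longleftrightarrow> token_move (parcs G) A B"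
    (is "?L \<longleftrightarrow> ?R")
  proof
    assume ?L
    then obtain x y where xy: "sym_diff A B = {x, y}" "(x, y) \<in> parcs G" by blast
    \<comment> \<open>The two differences have equal size, so if one were empty, the whole symmetric
      difference would be. This also excludes \<open>x = y\<close>.\<close>
    have "A - B \<noteq> {}" "B - A \<noteq> {}"
      using xy(1) diff fin by (metis Un_empty card_0_eq finite_Diff insert_not_empty)+
    then have ex: "\<exists>z. z \<in> A \<and> z \<notin> B" "\<exists>z. z \<in> B \<and> z \<notin> A"
      by blast+
    have mem: "(z \<in> A) \<noteq> (z \<in> B) \<longleftrightarrow> z = x \<or> z = y" for z
      using xy(1) by (auto simp: set_eq_iff)
    consider "x \<in> A" "y \<notin> A" | "x \<notin> A" "y \<in> A"
      using ex mem by metis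
    then show ?R
    proof cases
      case 1
      have "z \<in> B \<longleftrightarrow> z \<in> insert y (A - {x})" for z using mem[of z] 1 by blast
      then have "B = insert y (A - {x})" by blast
      with 1 show ?thesis unfolding token_move_def using xy(2) by blast
    next
      \<comment> \<open>Here the token sits at \<open>y\<close> and moves along the reversed
        arc.\<close>
      case 2
      have "z \<in> B \<longleftrightarrow> z \<in> insert x (A - {y})" for z using mem[of z] 2 by blast
      then have "B = insert x (A - {y})" by blast
      with 2 show ?thesis unfolding token_move_def using symD[OF sym xy(2)] by blast
    qed
  next
    assume ?R
    then obtain x y where "(x, y) \<in> parcs G" "x \<in> A" "y \<notin> A" "B = insert y (A - {x})"
      unfolding token_move_def by blast
    moreover from this have "sym_diff A B = {x, y}" by auto
    ultimately show ?L by blast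
  qed
  with assms(2,3) show ?thesis by (simp add: token_graph_def Let_def)
qed

text \<open>Arcs of the union join vertices with the same tag, so a moving token stays in its fibre.
  Conversely a set of tagged vertices is recovered from its fibres, so a move in one fibre lifts to
  the whole set.\<close>

lemma token_move_indexed_disjoint_union:
  "token_move (parcs (indexed_disjoint_union I G)) S T \<longleftrightarrow>
    (\<exists>i\<in>I. token_move (parcs (G i)) (S `` {i}) (T `` {i}) \<and> (\<forall>j. j \<noteq> i \<longrightarrow> S `` {j} = T `` {j}))"
    (is "?L \<longleftrightarrow> ?R")
proof
  assume ?L
  then obtain i u v where m: "i \<in> I" "(u, v) \<in> parcs (G i)" "(i, u) \<in> S" "(i, v) \<notin> S"
    and T: "T = insert (i, v) (S - {(i, u)})"
    by (auto simp: token_move_def indexed_disjoint_union_def)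
  have "T `` {i} = insert v (S `` {i} - {u})" "\<forall>j. j \<noteq> i \<longrightarrow> S `` {j} = T `` {j}"
    unfolding T by auto
  with m show ?R unfolding token_move_def by blast
next
  assume ?R
  then obtain i u v where m: "i \<in> I" "(u, v) \<in> parcs (G i)" "(i, u) \<in> S" "(i, v) \<notin> S"
    and Ti: "T `` {i} = insert v (S `` {i} - {u})"
    and Tj: "\<And>j. j \<noteq> i \<Longrightarrow> S `` {j} = T `` {j}"
    unfolding token_move_def by blast
  have "(j, w) \<in> T \<longleftrightarrow> (j, w) \<in> insert (i, v) (S - {(i, u)})" for j w
    using Ti Tj[of j] by (cases "j = i") blast+
  then have "T = insert (i, v) (S - {(i, u)})" by auto
  with m show ?L by (force simp: token_move_def indexed_disjoint_union_def)
qed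

section \<open>The map from the summands to token sets\<close>

text \<open>The map starts from the summands because this direction needs no choice or sorting of
  tokens. The nesting of the sums and pairs follows the left associativity of \<oplus> and \<box>.
  In the mixed summand the first index carries two tokens and the second carries one.\<close>

fun three_tokens ::
    "(nat \<times> 'a set + (nat \<times> nat) \<times> 'a set \<times> 'a) + (nat \<times> nat \<times> nat) \<times> ('a \<times> 'a) \<times> 'a
      \<Rightarrow> (nat \<times> 'a) set" where
  "three_tokens (Inl (Inl (i, A))) = {i} \<times> A"
| "three_tokens (Inl (Inr ((i, j), (A, b)))) = insert (j, b) ({i} \<times> A)"
| "three_tokens (Inr ((i, j, k), ((a, b), c))) = {(i, a), (j, b), (k, c)}"

text \<open>The fibre sizes of a token set, as a function of its summand alone. The overlapping
  tests are harmless since the index sets contain only tuples of distinct indices.\<close>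

fun profile :: "(nat + nat \<times> nat) + nat \<times> nat \<times> nat \<Rightarrow> nat \<Rightarrow> nat" where
  "profile (Inl (Inl i)) l = (if l = i then 3 else 0)"
| "profile (Inl (Inr (i, j))) l = (if l = i then 2 else if l = j then 1 else 0)"
| "profile (Inr (i, j, k)) l = (if l = i \<or> l = j \<or> l = k then 1 else 0)"

abbreviation three_token_summands where
  "three_token_summands n G \<equiv>
    indexed_disjoint_union {1..n} (\<lambda>i. token_graph 3 (G i))
    \<oplus> indexed_disjoint_union {(i, j). i \<in> {1..n} \<and> j \<in> {1..n} \<and> i \<noteq> j}
         (\<lambda>(i, j). token_graph 2 (G i) \<box> G j)
    \<oplus> indexed_disjoint_union {(i, j, k). 1 \<le> i \<and> i < j \<and> j < k \<and> k \<le> n}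
         (\<lambda>(i, j, k). G i \<box> G j \<box> G k)"

abbreviation "summand_index \<equiv> map_sum (map_sum fst fst) fst"

lemma pverts_token_graph:
  "pverts (token_graph k G) = {A. A \<subseteq> pverts G \<and> finite A \<and> card A = k}"
  by (simp add: token_graph_def Let_def)

lemma pverts_cartesian_product [simp]: "pverts (G \<box> H) = pverts G \<times> pverts H"
  by (simp add: cartesian_product_def Let_def)

lemma three_token_summands_cases [consumes 1, case_names three two_one one_one_one]:
  assumes "p \<in> pverts (three_token_summands n G)"
  obtains i A where "p = Inl (Inl (i, A))" "i \<in> {1..n}" "A \<in> pverts (token_graph 3 (G i))"
  | i j A b where "p = Inl (Inr ((i, j), (A, b)))" "i \<in> {1..n}" "j \<in> {1..n}" "i \<noteq> j"
      "A \<in> pverts (token_graph 2 (G i))" "b \<in> pverts (G j)"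
  | i j k a b c where "p = Inr ((i, j, k), ((a, b), c))" "1 \<le> i" "i < j" "j < k" "k \<le> n"
      "a \<in> pverts (G i)" "b \<in> pverts (G j)" "c \<in> pverts (G k)"
  using assms by (fastforce simp: disjoint_union_def indexed_disjoint_union_def)

section \<open>Fibre sizes determine the summand; injectivity\<close>

lemma card_fibre_three_tokens:
  assumes "p \<in> pverts (three_token_summands n G)"
  shows "card (three_tokens p `` {l}) = profile (summand_index p) l"
  using assms
proof (cases rule: three_token_summands_cases)
  case (three i A)
  have "({i} \<times> A) `` {l} = (if l = i then A else {})" by auto
  with three show ?thesis by (simp add: pverts_token_graph)
next
  case (two_one i j A b)
  have "insert (j, b) ({i} \<times> A) `` {l} = (if l = i then A else if l = j then {b} else {})"
    using two_one by auto
  with two_one show ?thesis by (simp add: pverts_token_graph)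
next
  case (one_one_one i j k a b c)
  have "{(i, a), (j, b), (k, c)} `` {l} =
      (if l = i then {a} else if l = j then {b} else if l = k then {c} else {})"
    using one_one_one by auto
  with one_one_one show ?thesis by simp
qed

text \<open>The largest fibre size, 3, 2 or 1, tells the type of summand. Within a type, the places
  of the nonzero sizes give the index. The lemma serves both injectivity and the absence of arcs
  between different summands.\<close>

lemma summand_index_eqI:
  assumes p: "p \<in> pverts (three_token_summands n G)" and q: "q \<in> pverts (three_token_summands n G)"
    and eq: "\<And>l. card (three_tokens p `` {l}) = card (three_tokens q `` {l})"
  shows "summand_index p = summand_index q"
proof -
  have prof: "profile (summand_index p) l = profile (summand_index q) l" for l
    using eq[of l] by (simp only: card_fibre_three_tokens[OF p] card_fibre_three_tokens[OF q])
  from p show ?thesis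
  proof (cases rule: three_token_summands_cases)
    case p: (three i A)
    from q show ?thesis
    proof (cases rule: three_token_summands_cases)
      case q: (three i' A')
      show ?thesis using prof[of i] by (simp add: p(1) q(1) split: if_splits)
    next
      case q: (two_one i' j' A' b')
      show ?thesis using prof[of i] by (simp add: p(1) q(1) split: if_splits)
    next
      case q: (one_one_one i' j' k' a' b' c')
      show ?thesis using prof[of i] by (simp add: p(1) q(1) split: if_splits)
    qed
  next
    case p: (two_one i j A b)
    from q show ?thesis
    proof (cases rule: three_token_summands_cases)
      case q: (three i' A')
      show ?thesis using prof[of i] by (simp add: p(1) q(1) split: if_splits)
    next
      case q: (two_one i' j' A' b')
      show ?thesis using prof[of i] prof[of j] p(4) by (simp add: p(1) q(1) split: if_splits)
    next
      case q: (one_one_one i' j' k' a' b' c')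
      show ?thesis using prof[of i] by (simp add: p(1) q(1) split: if_splits)
    qed
  next
    case p: (one_one_one i j k a b c)
    from q show ?thesis
    proof (cases rule: three_token_summands_cases)
      case q: (three i' A')
      show ?thesis using prof[of i'] by (simp add: p(1) q(1) split: if_splits)
    next
      case q: (two_one i' j' A' b')
      show ?thesis using prof[of i'] by (simp add: p(1) q(1) split: if_splits)
    next
      case q: (one_one_one i' j' k' a' b' c')
      \<comment> \<open>Only the set of three occupied indices is known here. As both triples are
        increasing, their minima and maxima agree, and then so do the middle entries.\<close>
      have mem: "l = i \<or> l = j \<or> l = k \<longleftrightarrow> l = i' \<or> l = j' \<or> l = k'" for l
        using prof[of l] by (simp add: p(1) q(1) split: if_splits)
      have "i = i'"
        using mem[of i] mem[of i'] p(3,4) q(3,4) by (intro order.antisym) auto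
      moreover have "k = k'"
        using mem[of k] mem[of k'] p(3,4) q(3,4) by (intro order.antisym) auto
      ultimately have "i = i' \<and> j = j' \<and> k = k'"
        using mem[of j] p(3,4) by auto
      with p(1) q(1) show ?thesis by simp
    qed
  qed
qed

text \<open>Equal images have equal fibre sizes and hence come from the same summand, where the
  fibres give back every component of the vertex.\<close>

lemma inj_on_three_tokens: "inj_on three_tokens (pverts (three_token_summands n G))"
proof (rule inj_onI)
  fix p q
  assume p: "p \<in> pverts (three_token_summands n G)" and q: "q \<in> pverts (three_token_summands n G)"
    and eq: "three_tokens p = three_tokens q"
  have idx: "summand_index p = summand_index q"
    by (rule summand_index_eqI[OF p q]) (simp only: eq)
  have fib: "three_tokens p `` {l} = three_tokens q `` {l}" for l
    using eq by simp
  from p show "p = q"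
  proof (cases rule: three_token_summands_cases)
    case (three i A)
    from q show ?thesis
      by (cases rule: three_token_summands_cases) (use three idx eq in auto)
  next
    case (two_one i j A b)
    from q show ?thesis
      by (cases rule: three_token_summands_cases)
        (use two_one idx fib[of i] fib[of j] in auto)
  next
    case (one_one_one i j k a b c)
    from q show ?thesis
      by (cases rule: three_token_summands_cases)
        (use one_one_one idx fib[of i] fib[of j] fib[of k] in auto)
  qed
qed

section \<open>Surjectivity\<close>

lemma three_tokens_in_pverts:
  assumes "p \<in> pverts (three_token_summands n G)"
  shows "three_tokens p \<in> pverts (token_graph 3 (indexed_disjoint_union {1..n} G))"
  using assms
proof (cases rule: three_token_summands_cases)
  case (three i A)
  then show ?thesis
    by (auto simp: pverts_token_graph indexed_disjoint_union_def card_cartesian_product)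
next
  case (two_one i j A b)
  then have "card (insert (j, b) ({i} \<times> A)) = 3"
    by (subst card_insert_disjoint) (auto simp: pverts_token_graph card_cartesian_product)
  with two_one show ?thesis
    by (auto simp: pverts_token_graph indexed_disjoint_union_def)
next
  case (one_one_one i j k a b c)
  then show ?thesis
    by (auto simp: pverts_token_graph indexed_disjoint_union_def)
qed

text \<open>With the tokens listed by nondecreasing index, the ties among the indices select the
  summand. Where indices tie, distinctness of the tagged vertices becomes distinctness in one graph,
  which gives the token set of that graph its size.\<close>

lemma mem_three_tokens_image:
  fixes G :: "nat \<Rightarrow> 'a pair_pre_digraph"
  assumes I: "{i, j, k} \<subseteq> {1..n}"
    and a: "a \<in> pverts (G i)" and b: "b \<in> pverts (G j)" and c: "c \<in> pverts (G k)"
    and d: "(i, a) \<noteq> (j, b)" "(i, a) \<noteq> (k, c)" "(j, b) \<noteq> (k, c)"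
    and le: "i \<le> j" "j \<le> k"
  shows "{(i, a), (j, b), (k, c)} \<in> three_tokens ` pverts (three_token_summands n G)"
proof -
  note simps = disjoint_union_def indexed_disjoint_union_def pverts_token_graph
  consider "i = j" "j = k" | "i = j" "j < k" | "i < j" "j = k" | "i < j" "j < k"
    using le by linarith
  then show ?thesis
  proof cases
    case 1
    let ?p = "Inl (Inl (i, {a, b, c}))"
    have "?p \<in> pverts (three_token_summands n G)"
      using 1 I a b c d by (auto simp: simps)
    moreover have "{(i, a), (j, b), (k, c)} = three_tokens ?p" using 1 by auto
    ultimately show ?thesis by (rule rev_image_eqI)
  next
    case 2
    let ?p = "Inl (Inr ((i, k), ({a, b}, c)))"
    have "?p \<in> pverts (three_token_summands n G)"
      using 2 I a b c d by (auto simp: simps)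
    moreover have "{(i, a), (j, b), (k, c)} = three_tokens ?p" using 2 by auto
    ultimately show ?thesis by (rule rev_image_eqI)
  next
    case 3
    \<comment> \<open>The larger index carries two tokens, so it comes first. This is why the mixed
      summands range over all ordered pairs of distinct indices.\<close>
    let ?p = "Inl (Inr ((j, i), ({b, c}, a)))"
    have "?p \<in> pverts (three_token_summands n G)"
      using 3 I a b c d by (auto simp: simps)
    moreover have "{(i, a), (j, b), (k, c)} = three_tokens ?p" using 3 by auto
    ultimately show ?thesis by (rule rev_image_eqI)
  next
    case 4
    let ?p = "Inr ((i, j, k), ((a, b), c))"
    have "?p \<in> pverts (three_token_summands n G)"
      using 4 I a b c by (auto simp: simps)
    moreover have "{(i, a), (j, b), (k, c)} = three_tokens ?p" by simp
    ultimately show ?thesis by (rule rev_image_eqI)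
  qed
qed

lemma bij_betw_three_tokens:
  "bij_betw three_tokens (pverts (three_token_summands n G))
    (pverts (token_graph 3 (indexed_disjoint_union {1..n} G)))"
proof (rule bij_betw_imageI[OF inj_on_three_tokens], intro equalityI subsetI)
  fix S
  assume "S \<in> three_tokens ` pverts (three_token_summands n G)"
  then show "S \<in> pverts (token_graph 3 (indexed_disjoint_union {1..n} G))"
    using three_tokens_in_pverts by blast
next
  fix S
  assume "S \<in> pverts (token_graph 3 (indexed_disjoint_union {1..n} G))"
  then have sub: "S \<subseteq> (SIGMA i:{1..n}. pverts (G i))" and "card S = 3"
    by (auto simp: pverts_token_graph indexed_disjoint_union_def)
  then obtain x y z where S: "S = {x, y, z}" and d: "x \<noteq> y" "x \<noteq> z" "y \<noteq> z"
    by (metis card_3_iff)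
  \<comment> \<open>Every three-token set has a listing by nondecreasing index; the six possible
    orders are checked below.\<close>
  have sorted: "{u, v, w} \<in> three_tokens ` pverts (three_token_summands n G)"
    if "{u, v, w} = S" "u \<noteq> v" "u \<noteq> w" "v \<noteq> w" "fst u \<le> fst v" "fst v \<le> fst w" for u v w
    using mem_three_tokens_image[of "fst u" "fst v" "fst w" n "snd u" G "snd v" "snd w"] that sub
    by auto
  consider "fst x \<le> fst y" "fst y \<le> fst z" | "fst x \<le> fst z" "fst z \<le> fst y"
    | "fst y \<le> fst x" "fst x \<le> fst z" | "fst y \<le> fst z" "fst z \<le> fst x"
    | "fst z \<le> fst x" "fst x \<le> fst y" | "fst z \<le> fst y" "fst y \<le> fst x"
    by linarith
  then show "S \<in> three_tokens ` pverts (three_token_summands n G)"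
    by cases (use sorted[of x y z] sorted[of x z y] sorted[of y x z] sorted[of y z x]
      sorted[of z x y] sorted[of z y x] d in \<open>auto simp: S insert_commute\<close>)
qed

section \<open>Preservation of adjacency\<close>

text \<open>Both kinds of adjacency amount to a move in one fibre with all other fibres fixed. In a
  Cartesian product, this is the rule that exactly one coordinate changes, along an arc.\<close>

lemma parcs_three_tokens_iff:
  fixes G :: "nat \<Rightarrow> 'a pair_pre_digraph"
  assumes G: "\<And>i. i \<in> {1..n} \<Longrightarrow> pair_graph (G i)"
    and p: "p \<in> pverts (three_token_summands n G)" and q: "q \<in> pverts (three_token_summands n G)"
  shows "(p, q) \<in> parcs (three_token_summands n G) \<longleftrightarrow>
    (three_tokens p, three_tokens q) \<in> parcs (token_graph 3 (indexed_disjoint_union {1..n} G))"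
proof -
  let ?move = "\<lambda>l. token_move (parcs (G l)) (three_tokens p `` {l}) (three_tokens q `` {l}) \<and>
    (\<forall>m. m \<noteq> l \<longrightarrow> three_tokens p `` {m} = three_tokens q `` {m})"
  have "pair_graph (indexed_disjoint_union {1..n} G)"
    using G by (intro pair_graph_indexed_disjoint_union finite_atLeastAtMost)
  from parcs_token_graph_iff[OF this three_tokens_in_pverts[OF p] three_tokens_in_pverts[OF q]]
  have R: "(three_tokens p, three_tokens q)
      \<in> parcs (token_graph 3 (indexed_disjoint_union {1..n} G)) \<longleftrightarrow> (\<exists>l\<in>{1..n}. ?move l)"
    by (simp only: token_move_indexed_disjoint_union)
  have irr: "irrefl (parcs (G i))" if "i \<in> {1..n}" for i
    using G[OF that] by (simp add: pair_graph_iff)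
  show ?thesis
  proof (cases "summand_index p = summand_index q")
    \<comment> \<open>Neither side has an arc between different summands: a move would preserve all
      fibre sizes, and these determine the summand.\<close>
    case False
    then have "\<not> (\<exists>l\<in>{1..n}. ?move l)"
      using summand_index_eqI[OF p q] by (metis card_token_move)
    moreover have "(p, q) \<notin> parcs (three_token_summands n G)"
      using False by (auto simp: disjoint_union_def indexed_disjoint_union_def)
    ultimately show ?thesis using R by blast
  next
    case idx: True
    from p show ?thesis
    proof (cases rule: three_token_summands_cases)
      case (three i A)
      from q idx three obtain B where
        B: "q = Inl (Inl (i, B))" "B \<in> pverts (token_graph 3 (G i))"
        by (cases rule: three_token_summands_cases) auto
      have fib: "three_tokens p `` {l} = (if l = i then A else {})"
        "three_tokens q `` {l} = (if l = i then B else {})" for l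
        using three B by auto
      have "(p, q) \<in> parcs (three_token_summands n G) \<longleftrightarrow> (A, B) \<in> parcs (token_graph 3 (G i))"
        using three B by (auto simp: disjoint_union_def indexed_disjoint_union_def)
      also have "\<dots> \<longleftrightarrow> token_move (parcs (G i)) A B"
        using three B G by (simp add: parcs_token_graph_iff)
      \<comment> \<open>Fibres other than the one at \<open>i\<close> are empty, and nothing moves
        in an empty fibre.\<close>
      also have "\<dots> \<longleftrightarrow> (\<exists>l\<in>{1..n}. ?move l)"
        unfolding fib using three by auto
      finally show ?thesis using R by simp
    next
      case (two_one i j A a)
      from q idx two_one obtain B b where
        B: "q = Inl (Inr ((i, j), (B, b)))" "B \<in> pverts (token_graph 2 (G i))" "b \<in> pverts (G j)"
        by (cases rule: three_token_summands_cases) auto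
      have fib: "three_tokens p `` {l} = (if l = i then A else if l = j then {a} else {})"
        "three_tokens q `` {l} = (if l = i then B else if l = j then {b} else {})" for l
        using two_one B by auto
      have "(p, q) \<in> parcs (three_token_summands n G) \<longleftrightarrow>
          A = B \<and> (a, b) \<in> parcs (G j) \<or> a = b \<and> (A, B) \<in> parcs (token_graph 2 (G i))"
        using two_one B
        by (auto simp: disjoint_union_def indexed_disjoint_union_def cartesian_product_def Let_def)
      \<comment> \<open>Changing the first coordinate moves a token in the two-token fibre at
        \<open>i\<close>; changing the second moves the single token at \<open>j\<close>.\<close>
      also have "\<dots> \<longleftrightarrow> ?move i \<or> ?move j"
        unfolding fib using two_one B G by (auto simp: parcs_token_graph_iff token_move_singleton irr)
      also have "\<dots> \<longleftrightarrow> (\<exists>l\<in>{1..n}. ?move l)"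
        unfolding fib using two_one by (auto split: if_splits)
      finally show ?thesis using R by simp
    next
      case (one_one_one i j k a b c)
      from q idx one_one_one obtain a' b' c' where
        B: "q = Inr ((i, j, k), ((a', b'), c'))"
          "a' \<in> pverts (G i)" "b' \<in> pverts (G j)" "c' \<in> pverts (G k)"
        by (cases rule: three_token_summands_cases) auto
      have fib: "three_tokens p `` {l} =
          (if l = i then {a} else if l = j then {b} else if l = k then {c} else {})"
        "three_tokens q `` {l} =
          (if l = i then {a'} else if l = j then {b'} else if l = k then {c'} else {})" for l
        using one_one_one B by auto
      have "(p, q) \<in> parcs (three_token_summands n G) \<longleftrightarrow>
          (a, a') \<in> parcs (G i) \<and> b = b' \<and> c = c' \<or>
          a = a' \<and> (b, b') \<in> parcs (G j) \<and> c = c' \<or>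
          a = a' \<and> b = b' \<and> (c, c') \<in> parcs (G k)"
        using one_one_one B
        by (auto simp: disjoint_union_def indexed_disjoint_union_def cartesian_product_def Let_def)
      also have "\<dots> \<longleftrightarrow> ?move i \<or> ?move j \<or> ?move k"
      proof -
        have mem: "i \<in> {1..n}" "j \<in> {1..n}" "k \<in> {1..n}" and ne: "i \<noteq> j" "i \<noteq> k" "j \<noteq> k"
          using one_one_one by auto
        \<comment> \<open>The condition on the other fibres reduces to equality of the singletons at
          \<open>j\<close> and \<open>k\<close>, since all remaining fibres are empty on both
          sides.\<close>
        have "?move i \<longleftrightarrow> (a, a') \<in> parcs (G i) \<and> b = b' \<and> c = c'"
          unfolding fib using ne by (simp add: token_move_singleton[OF irr[OF mem(1)]]) metis
        moreover have "?move j \<longleftrightarrow> a = a' \<and> (b, b') \<in> parcs (G j) \<and> c = c'"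
          unfolding fib using ne by (simp add: token_move_singleton[OF irr[OF mem(2)]]) metis
        moreover have "?move k \<longleftrightarrow> a = a' \<and> b = b' \<and> (c, c') \<in> parcs (G k)"
          unfolding fib using ne by (simp add: token_move_singleton[OF irr[OF mem(3)]]) metis
        ultimately show ?thesis by simp
      qed
      also have "\<dots> \<longleftrightarrow> (\<exists>l\<in>{1..n}. ?move l)"
      proof -
        have "l = i \<or> l = j \<or> l = k" if "?move l" for l
          using that unfolding fib(1)[of l] by (auto split: if_splits)
        moreover have "i \<in> {1..n}" "j \<in> {1..n}" "k \<in> {1..n}"
          using one_one_one by auto
        ultimately show ?thesis by blast
      qed
      finally show ?thesis using R by simp
    qed
  qed
qed

section \<open>The isomorphism\<close>

lemma pair_graph_three_token_summands:
  fixes n :: nat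
  assumes "\<And>i. i \<in> {1..n} \<Longrightarrow> pair_graph (G i)"
  shows "pair_graph (three_token_summands n G)"
proof -
  have "finite {(i, j). i \<in> {1..n} \<and> j \<in> {1..n} \<and> i \<noteq> j}"
    by (rule finite_subset[of _ "{1..n} \<times> {1..n}"]) auto
  moreover have "finite {(i, j, k). 1 \<le> i \<and> i < j \<and> j < k \<and> k \<le> n}"
    by (rule finite_subset[of _ "{1..n} \<times> {1..n} \<times> {1..n}"]) auto
  ultimately show ?thesis
    using assms
    by (intro pair_graph_disjoint_union pair_graph_indexed_disjoint_union)
      (auto intro!: pair_graph_token_graph pair_graph_cartesian_product)
qed

theorem theorem2:
  fixes G :: "nat \<Rightarrow> 'a pair_pre_digraph" and n :: nat
  assumes "n \<ge> 2"
    and "\<And>i. i \<in> {1..n} \<Longrightarrow> pair_graph (G i)"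
  shows "digraph_iso
    (with_proj (token_graph 3 (indexed_disjoint_union {1..n} G)))
    (with_proj
      (indexed_disjoint_union {1..n} (\<lambda>i. token_graph 3 (G i))
       \<oplus> indexed_disjoint_union {(i, j). i \<in> {1..n} \<and> j \<in> {1..n} \<and> i \<noteq> j}
            (\<lambda>(i, j). token_graph 2 (G i) \<box> G j)
       \<oplus> indexed_disjoint_union {(i, j, k). 1 \<le> i \<and> i < j \<and> j < k \<and> k \<le> n}
            (\<lambda>(i, j, k). G i \<box> G j \<box> G k)))"
proof -
  let ?L = "token_graph 3 (indexed_disjoint_union {1..n} G)"
  let ?R = "three_token_summands n G"
  \<comment> \<open>The isomorphism sought leads from token sets to summands, so it is the inverse
    of \<open>three_tokens\<close>. Adjacency transfers because applying \<open>three_tokens\<close>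
    to \<open>?g u\<close> returns \<open>u\<close>.\<close>
  let ?g = "inv_into (pverts ?R) three_tokens"
  have "pair_graph ?L"
    using assms(2)
    by (intro pair_graph_token_graph pair_graph_indexed_disjoint_union finite_atLeastAtMost)
  moreover have "pair_graph ?R"
    using assms(2) by (rule pair_graph_three_token_summands)
  ultimately have wf: "pair_wf_digraph ?L" "pair_wf_digraph ?R"
    by (auto simp: pair_graph_iff intro!: pair_wf_digraph.intro)
  have bij: "bij_betw ?g (pverts ?L) (pverts ?R)"
    by (rule bij_betw_inv_into[OF bij_betw_three_tokens])
  have "(u, v) \<in> parcs ?L \<longleftrightarrow> (?g u, ?g v) \<in> parcs ?R"
    if u: "u \<in> pverts ?L" and v: "v \<in> pverts ?L" for u v
    using parcs_three_tokens_iff[OF assms(2) bij_betw_apply[OF bij u] bij_betw_apply[OF bij v]]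
    by (simp only: bij_betw_inv_into_right[OF bij_betw_three_tokens u]
        bij_betw_inv_into_right[OF bij_betw_three_tokens v])
  with bij show ?thesis
    unfolding digraph_iso_with_proj_iff[OF wf] by blast
qed

end
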